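(* Let $\mathcal I$ be an ideal of $\Phi^+$, and let $\mathcal I_{min}$ be its set of minimal roots. Then there exists $w \in W$ such that $w(\mathcal I_{min}) \subset \Pi$.
   Context: Let $G$ be a connected simple algebraic group over $\mathbf C$, $B$ a Borel subgroup, $T \subset B$ a maximal torus, $\Phi$ the (irreducible) root system of $(G,T)$, $W$ the Weyl group, and $\Pi \subset \Phi^+ \subset \Phi$ the simple and positive roots determined by $B$. For $\alpha,\beta\in\Phi$ write $\alpha \prec \beta$ if $\beta-\alpha$ is a sum of positive roots. An ideal of $\Phi^+$ is a subset $\mathcal I \subset \Phi^+$ such that if $\alpha \in \mathcal I$, $\beta \in \Phi^+$ and $\alpha+\beta \in \Phi^+$, then $\alpha+\beta \in \mathcal I$. The set $\mathcal I_{min}$ of minimal roots of $\mathcal I$ consists of those $\alpha \in \mathcal I$ such that $\beta\in\Phi^+$ and $\beta \prec \alpha$ imply $\beta \notin \mathcal I$. *)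

theory Defs
  imports "HOL-Analysis.Analysis"
begin

(* \<Delta> is the base \<Pi> of simple roots (the symbol \<Pi> is taken by FuncSet syntax).
   The ambient space is X(T) \<otimes> R with a W-invariant inner product, T being a maximal torus
   of the simple group G.  Only the root system of (G,T) and the choice of base made by B matter. *)

definition reflection :: "'a::euclidean_space \<Rightarrow> 'a \<Rightarrow> 'a" where
  "reflection \<alpha> x = x - (2 * (x \<bullet> \<alpha>) / (\<alpha> \<bullet> \<alpha>)) *\<^sub>R \<alpha>"

definition root_system :: "'a::euclidean_space set \<Rightarrow> bool" where
  "root_system \<Phi> \<longleftrightarrow>
     finite \<Phi> \<and> 0 \<notin> \<Phi> \<and> span \<Phi> = UNIV \<and>
     (\<forall>\<alpha>\<in>\<Phi>. reflection \<alpha> ` \<Phi> = \<Phi>) \<and>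
     (\<forall>\<alpha>\<in>\<Phi>. \<forall>\<beta>\<in>\<Phi>. 2 * (\<beta> \<bullet> \<alpha>) / (\<alpha> \<bullet> \<alpha>) \<in> \<int>) \<and>
     (\<forall>\<alpha>\<in>\<Phi>. \<forall>c. c *\<^sub>R \<alpha> \<in> \<Phi> \<longrightarrow> c = 1 \<or> c = -1)"

definition irreducible_root_system :: "'a::euclidean_space set \<Rightarrow> bool" where
  "irreducible_root_system \<Phi> \<longleftrightarrow>
     root_system \<Phi> \<and> \<Phi> \<noteq> {} \<and>
     \<not> (\<exists>A B. A \<noteq> {} \<and> B \<noteq> {} \<and> \<Phi> = A \<union> B \<and> A \<inter> B = {} \<and>
              (\<forall>\<alpha>\<in>A. \<forall>\<beta>\<in>B. \<alpha> \<bullet> \<beta> = 0))"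

inductive_set weyl_group :: "('a::euclidean_space) set \<Rightarrow> ('a \<Rightarrow> 'a) set" for \<Phi> where
  weyl_id: "id \<in> weyl_group \<Phi>"
| weyl_reflection: "\<alpha> \<in> \<Phi> \<Longrightarrow> w \<in> weyl_group \<Phi> \<Longrightarrow> reflection \<alpha> \<circ> w \<in> weyl_group \<Phi>"

definition simple_roots :: "'a::euclidean_space set \<Rightarrow> 'a set \<Rightarrow> bool" where
  "simple_roots \<Phi> \<Delta> \<longleftrightarrow>
     \<Delta> \<subseteq> \<Phi> \<and> independent \<Delta> \<and>
     (\<forall>\<alpha>\<in>\<Phi>. \<exists>c::'a \<Rightarrow> int. \<alpha> = (\<Sum>\<beta>\<in>\<Delta>. of_int (c \<beta>) *\<^sub>R \<beta>) \<and>
        ((\<forall>\<beta>\<in>\<Delta>. 0 \<le> c \<beta>) \<or> (\<forall>\<beta>\<in>\<Delta>. c \<beta> \<le> 0)))"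

definition positive_roots :: "'a::euclidean_space set \<Rightarrow> 'a set \<Rightarrow> 'a set" where
  "positive_roots \<Phi> \<Delta> =
     {\<alpha>\<in>\<Phi>. \<exists>c::'a \<Rightarrow> int. \<alpha> = (\<Sum>\<beta>\<in>\<Delta>. of_int (c \<beta>) *\<^sub>R \<beta>) \<and> (\<forall>\<beta>\<in>\<Delta>. 0 \<le> c \<beta>)}"

(* The sum is nonempty: with the empty sum allowed the relation would be reflexive
   and no ideal would have any minimal roots. *)
definition root_less :: "'a::euclidean_space set \<Rightarrow> 'a \<Rightarrow> 'a \<Rightarrow> bool" where
  "root_less P \<alpha> \<beta> \<longleftrightarrow> (\<exists>xs. xs \<noteq> [] \<and> set xs \<subseteq> P \<and> \<beta> - \<alpha> = sum_list xs)"

definition root_ideal :: "'a::euclidean_space set \<Rightarrow> 'a set \<Rightarrow> bool" where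
  "root_ideal P I \<longleftrightarrow>
     I \<subseteq> P \<and> (\<forall>\<alpha>\<in>I. \<forall>\<beta>\<in>P. \<alpha> + \<beta> \<in> P \<longrightarrow> \<alpha> + \<beta> \<in> I)"

definition minimal_roots :: "'a::euclidean_space set \<Rightarrow> 'a set \<Rightarrow> 'a set" where
  "minimal_roots P I = {\<alpha>\<in>I. \<forall>\<beta>\<in>P. root_less P \<beta> \<alpha> \<longrightarrow> \<beta> \<notin> I}"

end

theory Submission
  imports Defs
begin

text \<open>
  The minimal roots \<open>M\<close> of the ideal are pairwise incomparable, so no difference of two of them
  is a root. Hence they are pairwise obtuse, they lie in an open half space, and they are
  linearly independent. Let \<open>x\<close> be the vector in their span that has inner product 1 with each of
  them, and call the inner product of a root with \<open>x\<close> its height. A linearly independent set of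
  roots is conjugate to a set of simple roots as soon as it is a base of the roots in its span. In
  terms of heights, it suffices that every root in the span of \<open>M\<close> has a nonzero integral height
  (\<open>conjugate_to_simple\<close>). Then a chamber can be moved into the dominant one so that every member
  of \<open>M\<close> becomes a nonnegative combination of simple roots, and having height 1 it can only
  be a single simple root.

  That heights do not vanish is where the ideal comes in. A root in the span of \<open>M\<close> is a rational
  combination of \<open>M\<close> (\<open>root_in_span_rational\<close>). If it had height 0, clearing denominators and
  separating signs would turn this into an equality between two equally long sums of minimal roots,
  one of which is increased by positive roots. The lemma \<open>exchange\<close> forbids this by cancelling
  roots with positive inner product until nothing is left.

  Integrality has two steps. As no root of the span is orthogonal to \<open>x\<close>, the group generated by
  the reflections in \<open>M\<close> contains an element that maps \<open>x\<close> to \<open>- x\<close>. It changes heights by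
  integers and negates them, so twice a height is an integer (\<open>twice_height_int\<close>). The height 1/2
  is then ruled out by counting (\<open>no_root_of_height_half\<close>). The roots of height 1/2, together with
  the members of \<open>M\<close> that are not sums of two of these, form an independent set. So there are at
  most as many roots of height 1/2 as members of \<open>M\<close> that are sums of two of them. But such sums
  are edges of a Dynkin diagram whose vertices are the roots of height 1/2, and Dynkin diagrams are
  forests. Subtracting members of \<open>M\<close> reduces other half-integral heights to this case.
\<close>

section \<open>Obtuse sets and generic vectors\<close>

definition pos_part :: "('a \<Rightarrow> real) \<Rightarrow> 'a set \<Rightarrow> 'a::euclidean_space" where
  "pos_part f A = (\<Sum>a\<in>A. max (f a) 0 *\<^sub>R a)"

lemma pos_part_diff: "pos_part f A - pos_part (\<lambda>a. - f a) A = (\<Sum>a\<in>A. f a *\<^sub>R a)"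
  unfolding pos_part_def sum_subtractf[symmetric] by (intro sum.cong) (auto simp: max_def)

lemma inner_pos_part: "pos_part f A \<bullet> u = (\<Sum>a\<in>A. max (f a) 0 * (a \<bullet> u))"
  by (simp add: pos_part_def inner_sum_left)

lemma pos_part_coeff_nonpos:
  assumes "finite A" "\<And>a. a \<in> A \<Longrightarrow> 0 < a \<bullet> u" "pos_part f A = 0" "a \<in> A"
  shows "f a \<le> 0"
proof -
  have "(\<Sum>a\<in>A. max (f a) 0 * (a \<bullet> u)) = 0"
    using inner_pos_part[of f A u] assms(3) by simp
  hence "max (f a) 0 * (a \<bullet> u) = 0"
    using assms(2,4)
    by (subst (asm) sum_nonneg_eq_0_iff[OF assms(1)])
       (auto intro!: mult_nonneg_nonneg intro: less_imp_le)
  thus ?thesis using assms(2)[OF assms(4)] by (auto simp: max_def split: if_splits)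
qed

text \<open>The two parts have disjoint supports, so only inner products of distinct elements
  contribute.\<close>
lemma inner_pos_neg_part:
  assumes obtuse: "\<And>a b. a \<in> A \<Longrightarrow> b \<in> A \<Longrightarrow> a \<noteq> b \<Longrightarrow> a \<bullet> b \<le> 0"
  shows "pos_part f A \<bullet> pos_part (\<lambda>a. - f a) A \<le> 0"
proof -
  have "pos_part f A \<bullet> pos_part (\<lambda>a. - f a) A =
      (\<Sum>a\<in>A. \<Sum>b\<in>A. (max (f a) 0 * max (- f b) 0) * (a \<bullet> b))"
    unfolding inner_pos_part unfolding pos_part_def inner_sum_right
    by (simp add: sum_distrib_left mult_ac)
  also have "\<dots> \<le> 0"
  proof (intro sum_nonpos)
    fix a b assume "a \<in> A" "b \<in> A"
    show "(max (f a) 0 * max (- f b) 0) * (a \<bullet> b) \<le> 0"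
    proof (cases "a = b")
      case True thus ?thesis by (auto simp: max_def)
    next
      case False
      thus ?thesis using obtuse[OF \<open>a \<in> A\<close> \<open>b \<in> A\<close>] by (intro mult_nonneg_nonpos) auto
    qed
  qed
  finally show ?thesis .
qed

text \<open>In a linear relation the positive part equals the negative part, so that its square norm
  is an inner product of the two parts and hence vanishes; the open half space given by
  \<^term>\<open>u\<close> then forces every coefficient to be zero.\<close>
lemma obtuse_independent:
  fixes A :: "'a::euclidean_space set"
  assumes fin: "finite A"
    and obtuse: "\<And>a b. a \<in> A \<Longrightarrow> b \<in> A \<Longrightarrow> a \<noteq> b \<Longrightarrow> a \<bullet> b \<le> 0"
    and pos: "\<And>a. a \<in> A \<Longrightarrow> 0 < a \<bullet> u"
  shows "independent A"
proof (rule independent_if_scalars_zero[OF fin])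
  fix f :: "'a \<Rightarrow> real" and a
  assume sum0: "(\<Sum>a\<in>A. f a *\<^sub>R a) = 0" and a: "a \<in> A"
  have eq: "pos_part f A = pos_part (\<lambda>a. - f a) A" using pos_part_diff[of f A] sum0 by simp
  hence "pos_part f A \<bullet> pos_part f A \<le> 0" using inner_pos_neg_part[OF obtuse, of A f] by simp
  hence 0: "pos_part f A = 0" by (metis inner_eq_zero_iff inner_ge_zero order_antisym)
  have "f a \<le> 0" by (rule pos_part_coeff_nonpos[OF fin pos 0 a])
  moreover have "- f a \<le> 0"
    by (rule pos_part_coeff_nonpos[OF fin pos trans[OF eq[symmetric] 0] a])
  ultimately show "f a = 0" by simp
qed

text \<open>The sum of the vectors of the basis dual to \<^term>\<open>A\<close> in its span.\<close>
lemma independent_obtain_height: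
  fixes A :: "'a::euclidean_space set"
  assumes "independent A"
  obtains x where "x \<in> span A" "\<And>a. a \<in> A \<Longrightarrow> a \<bullet> x = 1"
proof -
  obtain g :: "'a \<Rightarrow> real" where g: "linear g" "\<forall>a\<in>A. g a = 1"
    using linear_independent_extend[OF assms, of "\<lambda>_. 1"] by blast
  define u where "u = adjoint g 1"
  have u: "a \<bullet> u = g a" for a
    using adjoint_works[OF g(1), of a 1] by (simp add: u_def)
  obtain y z where yz: "y \<in> span A" "\<And>w. w \<in> span A \<Longrightarrow> orthogonal z w" "u = y + z"
    using orthogonal_subspace_decomp_exists[of A u] by blast
  have "a \<bullet> y = 1" if "a \<in> A" for a
  proof -
    have "a \<bullet> z = 0" using yz(2)[of a] that by (simp add: span_base orthogonal_def inner_commute)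
    thus ?thesis using u[of a] g(2) that yz(3) by (simp add: inner_add_right)
  qed
  thus ?thesis using that yz(1) by blast
qed

text \<open>Elements of \<^term>\<open>F\<close> are treated one at a time: moving \<open>z\<close> along the component of the new
  element orthogonal to \<^term>\<open>span A\<close> spoils a condition for only finitely many step lengths.\<close>
lemma generic_orthogonal_vector:
  fixes A F :: "'a::euclidean_space set"
  assumes "finite F" "F \<inter> span A = {}"
  shows "\<exists>z. (\<forall>a\<in>span A. a \<bullet> z = 0) \<and> (\<forall>f\<in>F. f \<bullet> z \<noteq> 0)"
  using assms
proof (induction F rule: finite_induct)
  case empty
  show ?case by (intro exI[of _ 0]) auto
next
  case (insert f F)
  then obtain z where z: "\<And>a. a \<in> span A \<Longrightarrow> a \<bullet> z = 0" "\<And>g. g \<in> F \<Longrightarrow> g \<bullet> z \<noteq> 0" by auto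
  obtain p q where pq: "p \<in> span A" "\<And>w. w \<in> span A \<Longrightarrow> orthogonal q w" "f = p + q"
    using orthogonal_subspace_decomp_exists[of A f] by blast
  have "q \<noteq> 0" using insert.prems pq by auto
  have fq: "f \<bullet> q \<noteq> 0"
    using pq(2)[OF pq(1)] \<open>q \<noteq> 0\<close>
    by (simp add: pq(3) inner_add_left orthogonal_def inner_commute[of p q])
  define bad where "bad = (\<lambda>g. - (g \<bullet> z) / (g \<bullet> q)) ` insert f F"
  have "finite bad" using insert.hyps by (simp add: bad_def)
  then obtain t where t: "t \<notin> insert 0 bad"
    using ex_new_if_finite[OF infinite_UNIV_char_0, of "insert 0 bad"] by auto
  have "g \<bullet> (z + t *\<^sub>R q) \<noteq> 0" if "g \<in> insert f F" for g
  proof (cases "g \<bullet> q = 0")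
    case True
    hence "g \<in> F" using that fq by auto
    thus ?thesis using z(2) True by (simp add: inner_add_right)
  next
    case False
    have "t \<noteq> - (g \<bullet> z) / (g \<bullet> q)" using t that by (auto simp: bad_def)
    thus ?thesis using False by (auto simp: inner_add_right field_simps)
  qed
  moreover have "a \<bullet> (z + t *\<^sub>R q) = 0" if "a \<in> span A" for a
    using z(1)[OF that] pq(2)[OF that] by (simp add: inner_add_right orthogonal_def inner_commute)
  ultimately show ?case by blast
qed

section \<open>Roots and reflections\<close>

lemma inner_reflection: "\<alpha> \<noteq> 0 \<Longrightarrow> reflection \<alpha> x \<bullet> reflection \<alpha> y = x \<bullet> y"
  unfolding reflection_def
  by (simp add: inner_diff_left inner_diff_right inner_commute field_simps)

lemma linear_reflection: "linear (reflection \<alpha>)"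
  by (rule linearI) (auto simp: reflection_def inner_add_left algebra_simps add_divide_distrib)

lemma inner_reflection_left:
  "reflection \<alpha> x \<bullet> y = x \<bullet> y - (2 * (x \<bullet> \<alpha>) / (\<alpha> \<bullet> \<alpha>)) * (\<alpha> \<bullet> y)"
  by (simp add: reflection_def inner_diff_left)

locale roots =
  fixes \<Phi> :: "'a::euclidean_space set"
  assumes root_system: "root_system \<Phi>"
begin

lemma finite_roots: "finite \<Phi>" and zero_not_root: "0 \<notin> \<Phi>"
  and span_roots: "span \<Phi> = UNIV"
  using root_system by (auto simp: root_system_def)

lemma reflection_image: "\<alpha> \<in> \<Phi> \<Longrightarrow> reflection \<alpha> ` \<Phi> = \<Phi>"
  and cartan_int: "\<alpha> \<in> \<Phi> \<Longrightarrow> \<beta> \<in> \<Phi> \<Longrightarrow> 2 * (\<beta> \<bullet> \<alpha>) / (\<alpha> \<bullet> \<alpha>) \<in> \<int>"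
  and reduced: "\<alpha> \<in> \<Phi> \<Longrightarrow> c *\<^sub>R \<alpha> \<in> \<Phi> \<Longrightarrow> c = 1 \<or> c = -1"
  using root_system by (auto simp: root_system_def)

lemma reflection_root: "\<alpha> \<in> \<Phi> \<Longrightarrow> \<beta> \<in> \<Phi> \<Longrightarrow> reflection \<alpha> \<beta> \<in> \<Phi>"
  using reflection_image by blast

lemma root_pos: "\<alpha> \<in> \<Phi> \<Longrightarrow> 0 < \<alpha> \<bullet> \<alpha>"
  using zero_not_root by (auto simp: inner_gt_zero_iff)

lemma neg_root: assumes "\<alpha> \<in> \<Phi>" shows "- \<alpha> \<in> \<Phi>"
proof -
  have "reflection \<alpha> \<alpha> = - \<alpha>" using root_pos[OF assms] by (simp add: reflection_def scaleR_2)
  thus ?thesis using reflection_root[OF assms assms] by simp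
qed

lemma diff_root_commute: "\<alpha> - \<beta> \<in> \<Phi> \<longleftrightarrow> \<beta> - \<alpha> \<in> \<Phi>"
  using neg_root[of "\<alpha> - \<beta>"] neg_root[of "\<beta> - \<alpha>"] by auto

text \<open>If both Cartan integers of the pair were at least 2, the square norm of the difference would not
  be positive. So one of them is 1, and the corresponding reflection yields the difference.\<close>
lemma diff_root:
  assumes a: "\<alpha> \<in> \<Phi>" and b: "\<beta> \<in> \<Phi>" and ne: "\<alpha> \<noteq> \<beta>" and pos: "0 < \<alpha> \<bullet> \<beta>"
  shows "\<alpha> - \<beta> \<in> \<Phi>"
proof -
  obtain m n :: int where m: "2 * (\<beta> \<bullet> \<alpha>) / (\<alpha> \<bullet> \<alpha>) = m" and n: "2 * (\<alpha> \<bullet> \<beta>) / (\<beta> \<bullet> \<beta>) = n"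
    using cartan_int[OF a b] cartan_int[OF b a] by (auto elim!: Ints_cases)
  note p = root_pos[OF a] root_pos[OF b]
  have "real_of_int m > 0" "real_of_int n > 0"
    using pos p m n by (metis inner_commute divide_pos_pos mult_pos_pos zero_less_numeral)+
  hence mn: "m \<ge> 1" "n \<ge> 1" by auto
  have "m = 1 \<or> n = 1"
  proof (rule ccontr)
    assume "\<not> ?thesis"
    hence "real_of_int m \<ge> 2" "real_of_int n \<ge> 2" using mn by linarith+
    hence "\<alpha> \<bullet> \<alpha> \<le> \<beta> \<bullet> \<alpha>" "\<beta> \<bullet> \<beta> \<le> \<alpha> \<bullet> \<beta>"
      unfolding m[symmetric] n[symmetric] using p by (auto simp: field_simps)
    hence "(\<alpha> - \<beta>) \<bullet> (\<alpha> - \<beta>) \<le> 0"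
      by (simp add: inner_diff_left inner_diff_right inner_commute)
    thus False using ne by (metis eq_iff_diff_eq_0 inner_gt_zero_iff not_le)
  qed
  thus ?thesis
  proof
    assume "n = 1"
    hence "reflection \<beta> \<alpha> = \<alpha> - \<beta>" unfolding reflection_def n by simp
    thus ?thesis using reflection_root[OF b a] by simp
  next
    assume "m = 1"
    hence "reflection \<alpha> \<beta> = \<beta> - \<alpha>" unfolding reflection_def m by simp
    thus ?thesis using reflection_root[OF a b] diff_root_commute by simp
  qed
qed

text \<open>If the two roots were orthogonal, reflecting their sum in one of them would give their
  difference.\<close>
lemma sum_root_imp_neg:
  assumes a: "\<alpha> \<in> \<Phi>" and b: "\<beta> \<in> \<Phi>" and sum: "\<alpha> + \<beta> \<in> \<Phi>" and diff: "\<alpha> - \<beta> \<notin> \<Phi>"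
    and ne: "\<alpha> \<noteq> \<beta>"
  shows "\<alpha> \<bullet> \<beta> < 0"
proof (rule ccontr)
  assume "\<not> ?thesis"
  moreover have "\<alpha> \<bullet> \<beta> \<noteq> 0"
  proof
    assume 0: "\<alpha> \<bullet> \<beta> = 0"
    have "reflection \<beta> (\<alpha> + \<beta>) = \<alpha> - \<beta>"
      using root_pos[OF b] by (simp add: reflection_def inner_add_left 0 scaleR_2)
    thus False using reflection_root[OF b sum] diff by simp
  qed
  ultimately show False using diff_root[OF a b ne] diff by simp
qed

lemma weyl_group_mono: "A \<subseteq> B \<Longrightarrow> weyl_group A \<subseteq> weyl_group B"
proof
  fix w assume "A \<subseteq> B" "w \<in> weyl_group A"
  from this(2,1) show "w \<in> weyl_group B"
    by (induction w rule: weyl_group.induct) (auto intro: weyl_group.intros)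
qed

lemma weyl_linear: "w \<in> weyl_group \<Phi> \<Longrightarrow> linear w"
  by (induction rule: weyl_group.induct)
     (auto intro: linear_compose linear_reflection linear_ident simp del: o_apply
           simp: id_def)

lemma weyl_inner: "w \<in> weyl_group \<Phi> \<Longrightarrow> w x \<bullet> w y = x \<bullet> y"
proof (induction rule: weyl_group.induct)
  case (weyl_reflection \<alpha> w)
  hence "\<alpha> \<noteq> 0" using zero_not_root by auto
  thus ?case using weyl_reflection.IH by (simp add: inner_reflection)
qed simp

lemma weyl_image: "w \<in> weyl_group \<Phi> \<Longrightarrow> w ` \<Phi> = \<Phi>"
  by (induction rule: weyl_group.induct) (simp_all add: image_comp[symmetric] reflection_image del: o_apply)

lemma weyl_root: "w \<in> weyl_group \<Phi> \<Longrightarrow> \<beta> \<in> \<Phi> \<Longrightarrow> w \<beta> \<in> \<Phi>"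
  using weyl_image by blast

lemma finite_weyl: "finite (weyl_group \<Phi>)"
proof (rule finite_imageD)
  have "(\<lambda>w. restrict w \<Phi>) ` weyl_group \<Phi> \<subseteq> \<Phi> \<rightarrow>\<^sub>E \<Phi>"
    using weyl_root by auto
  thus "finite ((\<lambda>w. restrict w \<Phi>) ` weyl_group \<Phi>)"
    by (rule finite_subset) (intro finite_PiE finite_roots)
  show "inj_on (\<lambda>w. restrict w \<Phi>) (weyl_group \<Phi>)"
  proof (rule inj_onI)
    fix v w assume vw: "v \<in> weyl_group \<Phi>" "w \<in> weyl_group \<Phi>" "restrict v \<Phi> = restrict w \<Phi>"
    have "v \<beta> = w \<beta>" if "\<beta> \<in> \<Phi>" for \<beta> using vw(3) that by (metis restrict_apply')
    thus "v = w"
      using linear_eq_on_span[OF weyl_linear[OF vw(1)] weyl_linear[OF vw(2)], of \<Phi>] span_roots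
      by auto
  qed
qed

text \<open>Dominant vectors are found by maximising a linear functional on an orbit, both for the whole
  Weyl group and for the subgroup generated by the reflections in some of the roots.\<close>
lemma weyl_obtain_max:
  assumes "A \<subseteq> \<Phi>"
  obtains w where "w \<in> weyl_group A" "\<And>v. v \<in> weyl_group A \<Longrightarrow> v x \<bullet> y \<le> w x \<bullet> y"
proof -
  have fin: "finite (weyl_group A)"
    using weyl_group_mono[OF assms] finite_weyl finite_subset by blast
  have ne: "weyl_group A \<noteq> {}" using weyl_group.weyl_id by blast
  let ?V = "(\<lambda>w. w x \<bullet> y) ` weyl_group A"
  have "Max ?V \<in> ?V" using fin ne by (intro Max_in) auto
  then obtain w where "w \<in> weyl_group A" "w x \<bullet> y = Max ?V" by auto
  thus ?thesis using that fin by simp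
qed

lemma weyl_max_dominant:
  assumes A: "A \<subseteq> \<Phi>" and w: "w \<in> weyl_group A"
    and max: "\<And>v. v \<in> weyl_group A \<Longrightarrow> v x \<bullet> y \<le> w x \<bullet> y"
    and \<alpha>: "\<alpha> \<in> A" "0 < \<alpha> \<bullet> y"
  shows "0 \<le> w x \<bullet> \<alpha>"
proof (rule ccontr)
  assume n: "\<not> ?thesis"
  have "(reflection \<alpha> \<circ> w) x \<bullet> y \<le> w x \<bullet> y"
    by (rule max) (rule weyl_group.weyl_reflection[OF \<alpha>(1) w])
  hence "0 \<le> (2 * (w x \<bullet> \<alpha>) / (\<alpha> \<bullet> \<alpha>)) * (\<alpha> \<bullet> y)"
    by (simp add: inner_reflection_left)
  moreover have "2 * (w x \<bullet> \<alpha>) / (\<alpha> \<bullet> \<alpha>) < 0"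
    using n root_pos A \<alpha>(1) by (auto intro!: divide_neg_pos)
  ultimately show False using \<alpha>(2) mult_neg_pos not_le by blast
qed

end

section \<open>Sums of two simple roots\<close>

context roots begin

lemma cartan_le_minus_1:
  assumes "\<alpha> \<in> \<Phi>" "\<beta> \<in> \<Phi>" "\<alpha> \<bullet> \<beta> < 0"
  shows "\<alpha> \<bullet> \<alpha> \<le> - 2 * (\<alpha> \<bullet> \<beta>)"
proof -
  obtain m :: int where m: "2 * (\<beta> \<bullet> \<alpha>) / (\<alpha> \<bullet> \<alpha>) = m"
    using cartan_int[OF assms(1,2)] by (auto elim!: Ints_cases)
  note p = root_pos[OF assms(1)]
  have "2 * (\<beta> \<bullet> \<alpha>) / (\<alpha> \<bullet> \<alpha>) < 0"
    using assms(3) p by (simp add: inner_commute divide_neg_pos)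
  hence "m \<le> -1" using m by linarith
  hence "2 * (\<beta> \<bullet> \<alpha>) / (\<alpha> \<bullet> \<alpha>) \<le> -1" unfolding m by linarith
  thus ?thesis using p by (simp add: field_simps inner_commute)
qed

text \<open>The set \<^term>\<open>S\<close> behaves like a set of simple roots. Two of its elements add up to a root only
  if they are joined in its Dynkin diagram, and the diagram is a forest, hence has fewer edges than
  vertices. The inequality for a forest comes from normalising the vectors: the square norm of the
  sum of the unit vectors is positive, and every edge lowers it by at least 1.\<close>
lemma card_sums_less:
  assumes S: "S \<subseteq> \<Phi>" "S \<noteq> {}"
    and diff: "\<And>s t. s \<in> S \<Longrightarrow> t \<in> S \<Longrightarrow> s \<noteq> t \<Longrightarrow> s - t \<notin> \<Phi>"
    and pos: "\<And>s. s \<in> S \<Longrightarrow> 0 < s \<bullet> u"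
    and T: "T \<subseteq> \<Phi>" "\<And>t. t \<in> T \<Longrightarrow> \<exists>r\<in>S. \<exists>s\<in>S. t = r + s"
  shows "card T < card S"
proof -
  have fin: "finite S" "finite T" using S(1) T(1) finite_roots finite_subset by blast+
  \<comment> \<open>Ordered pairs, so every edge is counted twice.\<close>
  define Q where "Q = {p \<in> S \<times> S. fst p \<noteq> snd p \<and> fst p + snd p \<in> \<Phi>}"
  have finQ: "finite Q" unfolding Q_def using fin by simp
  have "\<forall>t\<in>T. \<exists>p. fst p \<in> S \<and> snd p \<in> S \<and> t = fst p + snd p" using T(2) by fastforce
  then obtain f where f: "\<And>t. t \<in> T \<Longrightarrow> fst (f t) \<in> S \<and> snd (f t) \<in> S \<and> t = fst (f t) + snd (f t)"
    by metis
  have ne: "fst (f t) \<noteq> snd (f t)" if t: "t \<in> T" for t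
  proof
    assume eq: "fst (f t) = snd (f t)"
    have "2 *\<^sub>R fst (f t) = t" using f[OF t] eq scaleR_2 by metis
    hence "2 *\<^sub>R fst (f t) \<in> \<Phi>" using T(1) t by auto
    thus False using reduced[of "fst (f t)" 2] f[OF t] S(1) by auto
  qed
  have "card T + card T = card (f ` T) + card ((prod.swap \<circ> f) ` T)"
  proof -
    have f_sum: "fst (f t) + snd (f t) = t" if "t \<in> T" for t using f[OF that] by metis
    have "inj_on f T" "inj_on (prod.swap \<circ> f) T"
      by (rule inj_on_inverseI[where g = "\<lambda>p. fst p + snd p"], simp add: f_sum add.commute)+
    thus ?thesis by (simp add: card_image del: o_apply)
  qed
  also have "\<dots> = card (f ` T \<union> (prod.swap \<circ> f) ` T)"
  proof (rule card_Un_disjoint[symmetric])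
    show "f ` T \<inter> (prod.swap \<circ> f) ` T = {}"
    proof (rule ccontr)
      assume "\<not> ?thesis"
      then obtain t r where tr: "t \<in> T" "r \<in> T" "f t = prod.swap (f r)" by fastforce
      have "t = r" using f[OF tr(1)] f[OF tr(2)] tr(3) by (metis add.commute fst_swap snd_swap)
      thus False using tr ne[OF tr(1)] by (metis fst_swap)
    qed
  qed (use fin in auto)
  also have "\<dots> \<le> card Q"
  proof (rule card_mono[OF finQ])
    have "f t \<in> Q" "prod.swap (f t) \<in> Q" if "t \<in> T" for t
      using f[OF that] ne[OF that] T(1) that
      by (auto simp: Q_def mem_Times_iff add.commute)
    thus "f ` T \<union> (prod.swap \<circ> f) ` T \<subseteq> Q" by auto
  qed
  finally have TQ: "2 * card T \<le> card Q" by simp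
  define e where "e s = (1 / norm s) *\<^sub>R s" for s :: 'a
  define v where "v = (\<Sum>s\<in>S. e s)"
  have nz: "norm s > 0" if "s \<in> S" for s using that S(1) zero_not_root by auto
  have "0 < (\<Sum>s\<in>S. e s \<bullet> u)"
    using S(2) fin nz pos by (intro sum_pos) (auto simp: e_def)
  hence "0 < v \<bullet> u" by (simp add: v_def inner_sum_left)
  hence "v \<noteq> 0" by auto
  hence "0 < v \<bullet> v" by simp
  also have "v \<bullet> v = (\<Sum>p\<in>S\<times>S. e (fst p) \<bullet> e (snd p))"
    unfolding v_def inner_sum_left unfolding inner_sum_right
    by (simp add: sum.cartesian_product case_prod_beta)
  also have "\<dots> \<le> (\<Sum>p\<in>S\<times>S. of_bool (fst p = snd p) - of_bool (p \<in> Q) / 2)"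
  proof (rule sum_mono)
    fix p assume "p \<in> S \<times> S"
    then obtain s t where p: "p = (s, t)" "s \<in> S" "t \<in> S" by auto
    note st = nz[OF p(2)] nz[OF p(3)]
    have ip: "e s \<bullet> e t = (s \<bullet> t) / (norm s * norm t)" by (simp add: e_def)
    consider "s = t" | "s \<noteq> t" "s + t \<in> \<Phi>" | "s \<noteq> t" "s + t \<notin> \<Phi>" by blast
    thus "e (fst p) \<bullet> e (snd p) \<le> of_bool (fst p = snd p) - of_bool (p \<in> Q) / 2"
    proof cases
      case 1
      thus ?thesis using ip st p by (simp add: Q_def power2_norm_eq_inner[symmetric] power2_eq_square)
    next
      case 2
      have neg: "s \<bullet> t < 0"
        using sum_root_imp_neg[of s t] 2 diff p S(1) by blast
      have "s \<bullet> s \<le> - 2 * (s \<bullet> t)" "t \<bullet> t \<le> - 2 * (s \<bullet> t)"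
        using cartan_le_minus_1[of s t] cartan_le_minus_1[of t s] neg p S(1)
        by (auto simp: inner_commute)
      moreover have "2 * (norm s * norm t) \<le> s \<bullet> s + t \<bullet> t"
        using sum_squares_bound[of "norm s" "norm t"] by (simp add: power2_norm_eq_inner)
      \<comment> \<open>This is an inequality of the form cosine at most -1/2.\<close>
      ultimately have "norm s * norm t \<le> - 2 * (s \<bullet> t)" by simp
      hence "(s \<bullet> t) / (norm s * norm t) \<le> - 1 / 2"
        using st by (simp add: divide_le_eq)
      thus ?thesis using ip 2 p by (simp add: Q_def)
    next
      case 3
      hence "s \<bullet> t \<le> 0" using diff_root[of s t] diff p S(1) by (meson not_le subsetD)
      thus ?thesis using ip 3 p st by (simp add: Q_def divide_nonpos_pos)
    qed
  qed
  also have "\<dots> = real (card S) - real (card Q) / 2"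
  proof -
    have "(\<Sum>p\<in>S\<times>S. of_bool (fst p = snd p)) = (\<Sum>s\<in>S. \<Sum>t\<in>S. of_bool (s = t) :: real)"
      by (simp add: sum.cartesian_product case_prod_beta)
    also have "\<dots> = real (card S)" using fin by (simp add: of_bool_def)
    finally have 1: "(\<Sum>p\<in>S\<times>S. of_bool (fst p = snd p) :: real) = real (card S)" .
    have "(\<Sum>p\<in>S\<times>S. of_bool (p \<in> Q) :: real) = real (card ((S \<times> S) \<inter> Q))"
      using fin by (simp add: of_bool_def sum.If_cases)
    also have "(S \<times> S) \<inter> Q = Q" by (auto simp: Q_def)
    finally show ?thesis using 1 by (simp add: sum_subtractf sum_divide_distrib[symmetric])
  qed
  finally have "real (card Q) < real (2 * card S)" by simp
  hence "card Q < 2 * card S" by linarith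
  thus ?thesis using TQ by linarith
qed

end

section \<open>Sets of roots of height one\<close>

text \<open>The vector \<^term>\<open>x\<close> measures the height of a root with respect to \<^term>\<open>A\<close>. The results of this
  section say that \<^term>\<open>A\<close> behaves like a base of the roots in its span as soon as none of these
  roots has height 0; at the start not even the rationality of the heights is known.\<close>
locale unit_height = roots \<Phi> for \<Phi> :: "'a::euclidean_space set" +
  fixes A :: "'a set" and x :: 'a
  assumes A_roots: "A \<subseteq> \<Phi>"
    and A_diff: "\<And>\<alpha> \<beta>. \<alpha> \<in> A \<Longrightarrow> \<beta> \<in> A \<Longrightarrow> \<alpha> \<noteq> \<beta> \<Longrightarrow> \<alpha> - \<beta> \<notin> \<Phi>"
    and x_span: "x \<in> span A"
    and height_1: "\<And>\<alpha>. \<alpha> \<in> A \<Longrightarrow> \<alpha> \<bullet> x = 1"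
    and regular: "\<And>\<beta>. \<beta> \<in> \<Phi> \<Longrightarrow> \<beta> \<in> span A \<Longrightarrow> \<beta> \<bullet> x \<noteq> 0"
begin

lemma finite_A: "finite A"
  using A_roots finite_roots finite_subset by blast

lemma A_obtuse: "\<alpha> \<in> A \<Longrightarrow> \<beta> \<in> A \<Longrightarrow> \<alpha> \<noteq> \<beta> \<Longrightarrow> \<alpha> \<bullet> \<beta> \<le> 0"
  using diff_root[of \<alpha> \<beta>] A_diff A_roots by (meson not_le subsetD)

text \<open>A dominant vector lies in the cone spanned by the simple roots: its product with the negative
  part \<open>q\<close> of its expansion is nonnegative by dominance and at most \<open>- (q \<bullet> q)\<close> by
  obtuseness.\<close>
lemma x_nonneg_combination:
  obtains c where "x = (\<Sum>\<alpha>\<in>A. c \<alpha> *\<^sub>R \<alpha>)" "\<And>\<alpha>. \<alpha> \<in> A \<Longrightarrow> 0 \<le> c \<alpha>"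
proof -
  obtain c where c: "x = (\<Sum>\<alpha>\<in>A. c \<alpha> *\<^sub>R \<alpha>)"
    using x_span span_finite[OF finite_A] by auto
  define q where "q = pos_part (\<lambda>\<alpha>. - c \<alpha>) A"
  have "x \<bullet> q = pos_part c A \<bullet> q - q \<bullet> q"
    unfolding q_def inner_diff_left[symmetric] pos_part_diff c[symmetric] ..
  moreover have "pos_part c A \<bullet> q \<le> 0"
    unfolding q_def using A_obtuse by (rule inner_pos_neg_part)
  moreover have "q \<bullet> x = (\<Sum>\<alpha>\<in>A. max (- c \<alpha>) 0)"
    by (simp add: q_def inner_pos_part height_1)
  hence "0 \<le> x \<bullet> q" by (simp add: sum_nonneg inner_commute)
  ultimately have "q \<bullet> q \<le> 0" by simp
  hence q0: "q = 0" by (metis inner_eq_zero_iff inner_ge_zero order_antisym)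
  have "0 \<le> c \<alpha>" if "\<alpha> \<in> A" for \<alpha>
    using pos_part_coeff_nonpos[OF finite_A _ q0[unfolded q_def] that, of x] height_1 by simp
  thus ?thesis using that c by blast
qed

text \<open>A reflection in \<^term>\<open>\<alpha>\<close> moves a root by an integral multiple of \<^term>\<open>\<alpha>\<close>, and \<^term>\<open>\<alpha>\<close>
  has height 1.\<close>
lemma weyl_A_displacement:
  assumes "w \<in> weyl_group A" "\<beta> \<in> \<Phi>"
  shows "w \<beta> - \<beta> \<in> span A" "w \<beta> \<bullet> x - \<beta> \<bullet> x \<in> \<int>"
proof -
  have "w \<beta> - \<beta> \<in> span A \<and> w \<beta> \<bullet> x - \<beta> \<bullet> x \<in> \<int>"
    using assms(1)
  proof (induction rule: weyl_group.induct)
    case weyl_id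
    show ?case by (simp add: span_zero)
  next
    case (weyl_reflection \<alpha> w)
    define m where "m = 2 * (w \<beta> \<bullet> \<alpha>) / (\<alpha> \<bullet> \<alpha>)"
    have "w \<beta> \<in> \<Phi>"
      using weyl_reflection(2) weyl_group_mono[OF A_roots] weyl_root assms(2) by blast
    hence m: "m \<in> \<int>" using cartan_int weyl_reflection(1) A_roots unfolding m_def by blast
    have r: "(reflection \<alpha> \<circ> w) \<beta> = w \<beta> - m *\<^sub>R \<alpha>"
      by (simp add: reflection_def m_def)
    have "(w \<beta> - \<beta>) - m *\<^sub>R \<alpha> \<in> span A"
      using weyl_reflection by (meson span_base span_diff span_scale)
    moreover have "(w \<beta> \<bullet> x - \<beta> \<bullet> x) - m \<in> \<int>"
      using weyl_reflection.IH by (intro Ints_diff[OF _ m]) blast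
    ultimately show ?case
      unfolding r by (simp add: inner_diff_left height_1[OF weyl_reflection(1)] algebra_simps)
  qed
  thus "w \<beta> - \<beta> \<in> span A" "w \<beta> \<bullet> x - \<beta> \<bullet> x \<in> \<int>" by auto
qed

text \<open>The role of \<open>w\<close> is that of the longest element: \<^term>\<open>x\<close> plays half the sum of the positive
  coroots. Among the images of \<^term>\<open>- x\<close> the one closest to \<^term>\<open>x\<close> has nonnegative, integral
  and, by regularity, nonzero products with \<^term>\<open>A\<close>. So they are all at least 1, and the image
  is \<^term>\<open>x\<close> plus a vector \<open>z\<close> in the dominant cone. Both have the same norm, which forces
  \<open>z = 0\<close>.\<close>
lemma weyl_A_negates_x:
  obtains w where "w \<in> weyl_group A" "w (- x) = x"
proof -
  obtain w where w: "w \<in> weyl_group A"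
    and max: "\<And>v. v \<in> weyl_group A \<Longrightarrow> v (- x) \<bullet> x \<le> w (- x) \<bullet> x"
    using weyl_obtain_max[OF A_roots] by blast
  have W: "w \<in> weyl_group \<Phi>" using w weyl_group_mono[OF A_roots] by blast
  define z where "z = w (- x) - x"
  have z: "0 \<le> z \<bullet> \<alpha>" if \<alpha>: "\<alpha> \<in> A" for \<alpha>
  proof -
    have nn: "0 \<le> w (- x) \<bullet> \<alpha>"
      using weyl_max_dominant[OF A_roots w, of "- x" x \<alpha>] max \<alpha> height_1[OF \<alpha>] by simp
    obtain \<beta> where \<beta>: "\<beta> \<in> \<Phi>" "w \<beta> = \<alpha>"
      using \<alpha> A_roots weyl_image[OF W] by (metis imageE subsetD)
    have eq: "w (- x) \<bullet> \<alpha> = - (\<beta> \<bullet> x)"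
      unfolding \<beta>(2)[symmetric] weyl_inner[OF W] by (simp add: inner_commute)
    have "\<alpha> - (\<alpha> - \<beta>) \<in> span A"
      using weyl_A_displacement(1)[OF w \<beta>(1)] span_diff[OF span_base[OF \<alpha>]] unfolding \<beta>(2) by blast
    hence "\<beta> \<bullet> x \<noteq> 0" using regular[OF \<beta>(1)] by simp
    moreover have "1 - (1 - \<beta> \<bullet> x) \<in> \<int>"
      using weyl_A_displacement(2)[OF w \<beta>(1)] height_1[OF \<alpha>] \<beta>(2) by (intro Ints_diff) auto
    hence "\<beta> \<bullet> x \<in> \<int>" by simp
    then obtain k :: int where "\<beta> \<bullet> x = k" by (auto elim: Ints_cases)
    ultimately have "1 \<le> w (- x) \<bullet> \<alpha>" using nn eq by simp
    thus ?thesis using height_1[OF \<alpha>] by (simp add: z_def inner_diff_left inner_commute[of x])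
  qed
  obtain c where c: "x = (\<Sum>\<alpha>\<in>A. c \<alpha> *\<^sub>R \<alpha>)" "\<And>\<alpha>. \<alpha> \<in> A \<Longrightarrow> 0 \<le> c \<alpha>"
    using x_nonneg_combination by blast
  have "z \<bullet> x = (\<Sum>\<alpha>\<in>A. c \<alpha> * (z \<bullet> \<alpha>))"
    by (subst c(1)) (simp add: inner_sum_right)
  hence zx: "0 \<le> z \<bullet> x" using c(2) z by (simp add: sum_nonneg)
  have "x \<bullet> x = w (- x) \<bullet> w (- x)" using weyl_inner[OF W] by simp
  also have "\<dots> = (x + z) \<bullet> (x + z)" by (simp add: z_def)
  finally have "z \<bullet> z + 2 * (z \<bullet> x) = 0"
    by (simp add: inner_add_left inner_add_right inner_commute)
  hence "z = 0" using zx by (smt (verit) inner_eq_zero_iff inner_ge_zero)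
  thus ?thesis using that w by (simp add: z_def)
qed

text \<open>The element \<open>w\<close> that negates \<^term>\<open>x\<close> negates the height of \<^term>\<open>\<beta>\<close>, but changes it only by
  an integer.\<close>
lemma twice_height_int:
  assumes "\<beta> \<in> \<Phi>" shows "2 * (\<beta> \<bullet> x) \<in> \<int>"
proof -
  obtain w where w: "w \<in> weyl_group A" "w (- x) = x" using weyl_A_negates_x by blast
  have W: "w \<in> weyl_group \<Phi>" using w weyl_group_mono[OF A_roots] by blast
  have "w \<beta> \<bullet> x = w \<beta> \<bullet> w (- x)" using w by simp
  also have "\<dots> = - (\<beta> \<bullet> x)" using weyl_inner[OF W] by simp
  finally have "- (2 * (\<beta> \<bullet> x)) \<in> \<int>" using weyl_A_displacement(2)[OF w(1) assms] by simp
  thus ?thesis by simp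
qed

text \<open>Replace the members of \<^term>\<open>A\<close> that are sums of two roots of height 1/2 by all the roots of
  height 1/2. No difference of two of the resulting roots is a root, since it would have height 0
  or be a second summand of height 1/2; so the resulting set is independent and cannot be larger
  than \<^term>\<open>A\<close>. But a forest has fewer edges than vertices, so it is larger.\<close>
lemma no_root_of_height_half:
  assumes "\<beta> \<in> \<Phi>" "\<beta> \<in> span A" shows "\<beta> \<bullet> x \<noteq> 1 / 2"
proof
  assume "\<beta> \<bullet> x = 1 / 2"
  define S where "S = {\<beta> \<in> \<Phi>. \<beta> \<in> span A \<and> \<beta> \<bullet> x = 1 / 2}"
  define T where "T = {\<alpha> \<in> A. \<exists>r\<in>S. \<exists>s\<in>S. \<alpha> = r + s}"
  have S: "S \<subseteq> \<Phi>" "S \<noteq> {}" using \<open>\<beta> \<bullet> x = 1 / 2\<close> assms by (auto simp: S_def)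
  have finS: "finite S" using S finite_roots finite_subset by blast
  have Sdiff: "s - t \<notin> \<Phi>" if "s \<in> S" "t \<in> S" for s t
    using regular[of "s - t"] that by (auto simp: S_def span_diff inner_diff_left)
  have TS: "card T < card S"
    by (rule card_sums_less[OF S, where u = x]) (use Sdiff A_roots in \<open>auto simp: T_def S_def\<close>)
  have mixed: "\<alpha> - s \<notin> \<Phi>" if "\<alpha> \<in> A - T" "s \<in> S" for \<alpha> s
  proof
    assume "\<alpha> - s \<in> \<Phi>"
    hence "\<alpha> - s \<in> S" using that height_1[of \<alpha>]
      by (auto simp: S_def span_diff span_base inner_diff_left)
    hence "\<alpha> \<in> T" using that by (force simp: T_def intro!: bexI[of _ "\<alpha> - s"] bexI[of _ s])
    thus False using that by blast
  qed
  have "independent (S \<union> (A - T))"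
  proof (rule obtuse_independent)
    fix a b assume ab: "a \<in> S \<union> (A - T)" "b \<in> S \<union> (A - T)" "a \<noteq> b"
    hence "a \<in> \<Phi>" "b \<in> \<Phi>" using S A_roots by auto
    moreover have "a - b \<notin> \<Phi>"
      using ab Sdiff mixed[of a b] mixed[of b a] diff_root_commute[of a b] A_diff by blast
    ultimately show "a \<bullet> b \<le> 0" using diff_root[of a b] ab(3) by linarith
  next
    fix a assume "a \<in> S \<union> (A - T)"
    thus "0 < a \<bullet> x" using height_1[of a] by (auto simp: S_def)
  qed (use finS finite_A in auto)
  moreover have "S \<union> (A - T) \<subseteq> span A" by (auto simp: S_def span_base)
  ultimately have "card (S \<union> (A - T)) \<le> card A"
    using independent_span_bound[OF finite_A] by blast
  moreover have "card (S \<union> (A - T)) = card S + card (A - T)"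
    using finS finite_A height_1 by (intro card_Un_disjoint) (auto simp: S_def)
  moreover have "card A = card T + card (A - T)"
    using finite_A by (simp add: T_def card_Diff_subset card_mono)
  ultimately show False using TS by linarith
qed

text \<open>A root of positive height has positive inner product with some member of \<^term>\<open>A\<close>, because
  \<^term>\<open>x\<close> lies in the cone over \<^term>\<open>A\<close>; subtracting this member lowers the height by 1.\<close>
lemma no_root_of_half_integral_height:
  "\<beta> \<in> \<Phi> \<Longrightarrow> \<beta> \<in> span A \<Longrightarrow> \<beta> \<bullet> x \<noteq> real k + 1 / 2"
proof (induction k arbitrary: \<beta>)
  case 0
  thus ?case using no_root_of_height_half by simp
next
  case (Suc k)
  show ?case
  proof
    assume h: "\<beta> \<bullet> x = real (Suc k) + 1 / 2"
    obtain c where c: "x = (\<Sum>\<alpha>\<in>A. c \<alpha> *\<^sub>R \<alpha>)" "\<And>\<alpha>. \<alpha> \<in> A \<Longrightarrow> 0 \<le> c \<alpha>"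
      using x_nonneg_combination by blast
    have "\<beta> \<bullet> x = (\<Sum>\<alpha>\<in>A. c \<alpha> * (\<beta> \<bullet> \<alpha>))"
      by (subst c(1)) (simp add: inner_sum_right)
    hence "\<not> (\<Sum>\<alpha>\<in>A. c \<alpha> * (\<beta> \<bullet> \<alpha>)) \<le> 0" using h by simp
    then obtain \<alpha> where \<alpha>: "\<alpha> \<in> A" "\<not> c \<alpha> * (\<beta> \<bullet> \<alpha>) \<le> 0"
      using sum_nonpos[of A "\<lambda>\<alpha>. c \<alpha> * (\<beta> \<bullet> \<alpha>)"] by blast
    hence "0 < \<beta> \<bullet> \<alpha>" using c(2) mult_nonneg_nonpos not_le by blast
    note \<alpha> = \<alpha>(1) this
    have "\<beta> \<noteq> \<alpha>" using h height_1[OF \<alpha>(1)] by auto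
    hence "\<beta> - \<alpha> \<in> \<Phi>" using diff_root \<alpha> Suc.prems A_roots by blast
    moreover have "\<beta> - \<alpha> \<in> span A" using Suc.prems \<alpha> by (simp add: span_diff span_base)
    moreover have "(\<beta> - \<alpha>) \<bullet> x = real k + 1 / 2"
      using h height_1[OF \<alpha>(1)] by (simp add: inner_diff_left)
    ultimately show False using Suc.IH by blast
  qed
qed

lemma height_int:
  assumes "\<beta> \<in> \<Phi>" "\<beta> \<in> span A" shows "\<beta> \<bullet> x \<in> \<int>"
proof -
  obtain m :: int where m: "2 * (\<beta> \<bullet> x) = m"
    using twice_height_int[OF assms(1)] by (auto elim: Ints_cases)
  show ?thesis
  proof (cases "even m")
    case True
    then obtain k where "m = 2 * k" by blast
    hence "\<beta> \<bullet> x = of_int k" using m by simp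
    thus ?thesis by simp
  next
    case False
    then obtain k where k: "m = 2 * k + 1" by (auto elim: oddE)
    hence v: "\<beta> \<bullet> x = of_int k + 1 / 2" using m by simp
    have False
    proof (cases "0 \<le> k")
      case True
      hence "\<beta> \<bullet> x = real (nat k) + 1 / 2" using v by simp
      thus False using no_root_of_half_integral_height[OF assms] by blast
    next
      case False
      hence "(- \<beta>) \<bullet> x = real (nat (- k - 1)) + 1 / 2" using v by simp
      thus False using no_root_of_half_integral_height[of "- \<beta>"] assms neg_root span_neg by blast
    qed
    thus ?thesis ..
  qed
qed

end

section \<open>Rationality of linear relations between roots\<close>

lemma Dirichlet_approx_finite:
  fixes \<theta> :: "'b \<Rightarrow> real" and N :: nat
  assumes "finite A" "N > 0"
  obtains q :: int and p where "0 < q" "\<And>a. a \<in> A \<Longrightarrow> \<bar>of_int q * \<theta> a - of_int (p a)\<bar> < 1 / N"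
proof -
  obtain f where f: "bij_betw f {..<card A} A"
    using ex_bij_betw_nat_finite[OF assms(1)] by (auto simp: atLeast0LessThan)
  obtain q p where qp: "0 < q" "\<And>i. i < card A \<Longrightarrow> \<bar>of_int q * (\<theta> \<circ> f) i - of_int (p i)\<bar> < 1 / N"
    using Dirichlet_approx_simult[OF assms(2), of "card A" "\<theta> \<circ> f"] by metis
  define g where "g = inv_into {..<card A} f"
  have "\<bar>of_int q * \<theta> a - of_int ((p \<circ> g) a)\<bar> < 1 / N" if "a \<in> A" for a
  proof -
    have "g a < card A" "f (g a) = a"
      using that f bij_betw_inv_into_right[OF f that] bij_betw_apply[OF bij_betw_inv_into[OF f] that]
      by (auto simp: g_def)
    thus ?thesis using qp(2)[of "g a"] by simp
  qed
  thus ?thesis using that qp(1) by blast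
qed

context roots begin

text \<open>Approximate the real coefficients simultaneously by fractions with a common denominator \<open>q\<close>.
  Multiplying by \<open>q\<close> leaves an error that lies in the root lattice, so its Cartan numbers are
  integers. They are also smaller than 1 in absolute value, so the error is zero.\<close>
lemma root_in_span_rational:
  assumes A: "A \<subseteq> \<Phi>" and \<beta>: "\<beta> \<in> \<Phi>" "\<beta> \<in> span A"
  obtains q :: int and p :: "'a \<Rightarrow> int"
  where "0 < q" "of_int q *\<^sub>R \<beta> = (\<Sum>\<alpha>\<in>A. of_int (p \<alpha>) *\<^sub>R \<alpha>)"
proof -
  have finA: "finite A" using A finite_roots finite_subset by blast
  obtain \<theta> where \<theta>: "\<beta> = (\<Sum>\<alpha>\<in>A. \<theta> \<alpha> *\<^sub>R \<alpha>)"
    using \<beta>(2) span_finite[OF finA] by auto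
  define k where "k \<alpha> \<delta> = 2 * (\<alpha> \<bullet> \<delta>) / (\<delta> \<bullet> \<delta>)" for \<alpha> \<delta> :: 'a
  have k_sum: "k (\<Sum>\<alpha>\<in>A. c \<alpha> *\<^sub>R \<alpha>) \<delta> = (\<Sum>\<alpha>\<in>A. c \<alpha> * k \<alpha> \<delta>)" for c \<delta>
    by (simp add: k_def inner_sum_left sum_distrib_left sum_divide_distrib mult_ac)
  have k_diff: "k (u - v) \<delta> = k u \<delta> - k v \<delta>" and k_scale: "k (c *\<^sub>R u) \<delta> = c * k u \<delta>" for u v \<delta> c
    by (auto simp: k_def inner_diff_left diff_divide_distrib right_diff_distrib)
  define K where "K \<delta> = (\<Sum>\<alpha>\<in>A. \<bar>k \<alpha> \<delta>\<bar>)" for \<delta>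
  have K0: "0 \<le> K \<delta>" for \<delta> by (simp add: K_def sum_nonneg)
  define N where "N = Suc (nat \<lceil>\<Sum>\<delta>\<in>\<Phi>. K \<delta>\<rceil>)"
  have "K \<delta> < real N" if "\<delta> \<in> \<Phi>" for \<delta>
  proof -
    have "K \<delta> \<le> (\<Sum>\<delta>\<in>\<Phi>. K \<delta>)" using that finite_roots K0 by (intro member_le_sum) auto
    also have "\<dots> < real N" unfolding N_def by linarith
    finally show ?thesis .
  qed
  hence KN: "K \<delta> / N < 1" if "\<delta> \<in> \<Phi>" for \<delta> using that by (simp add: N_def)
  obtain q :: int and p where q: "0 < q"
    and p: "\<And>\<alpha>. \<alpha> \<in> A \<Longrightarrow> \<bar>of_int q * \<theta> \<alpha> - of_int (p \<alpha>)\<bar> < 1 / N"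
    using Dirichlet_approx_finite[OF finA, of N \<theta>] by (auto simp: N_def)
  define y where "y = of_int q *\<^sub>R \<beta> - (\<Sum>\<alpha>\<in>A. of_int (p \<alpha>) *\<^sub>R \<alpha>)"
  have y: "y = (\<Sum>\<alpha>\<in>A. (of_int q * \<theta> \<alpha> - of_int (p \<alpha>)) *\<^sub>R \<alpha>)"
    by (simp add: y_def \<theta> scaleR_sum_right scaleR_left_diff_distrib sum_subtractf)
  have "y \<bullet> \<delta> = 0" if \<delta>: "\<delta> \<in> \<Phi>" for \<delta>
  proof -
    have int: "k \<alpha> \<delta> \<in> \<int>" if "\<alpha> \<in> \<Phi>" for \<alpha> using cartan_int[OF \<delta> that] by (simp add: k_def)
    have "k y \<delta> \<in> \<int>"
      unfolding y_def k_diff k_scale k_sum using int \<beta>(1) A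
      by (intro Ints_diff Ints_mult Ints_sum Ints_of_int) auto
    moreover have "\<bar>k y \<delta>\<bar> < 1"
    proof -
      have "\<bar>k y \<delta>\<bar> \<le> (\<Sum>\<alpha>\<in>A. \<bar>(of_int q * \<theta> \<alpha> - of_int (p \<alpha>)) * k \<alpha> \<delta>\<bar>)"
        unfolding y k_sum by (rule sum_abs)
      also have "\<dots> \<le> (\<Sum>\<alpha>\<in>A. (1 / N) * \<bar>k \<alpha> \<delta>\<bar>)"
        unfolding abs_mult using p by (intro sum_mono mult_right_mono) (auto intro: less_imp_le)
      also have "\<dots> = K \<delta> / N" by (simp add: K_def sum_divide_distrib)
      finally show ?thesis using KN[OF \<delta>] by simp
    qed
    ultimately have "k y \<delta> = 0" by (auto elim!: Ints_cases)
    thus ?thesis using root_pos[OF \<delta>] by (simp add: k_def)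
  qed
  hence "orthogonal y y"
    using orthogonal_to_span[of y \<Phi> y] span_roots by (simp add: orthogonal_def)
  hence "y = 0" by (simp add: orthogonal_def)
  thus ?thesis using that[OF q, of p] by (simp add: y_def)
qed

end

section \<open>Positive roots and ideals\<close>

locale based_roots = roots \<Phi> for \<Phi> :: "'a::euclidean_space set" +
  fixes \<Delta> :: "'a set"
  assumes simple_roots: "simple_roots \<Phi> \<Delta>"
begin

abbreviation "P \<equiv> positive_roots \<Phi> \<Delta>"

lemma simple_subset: "\<Delta> \<subseteq> \<Phi>" and independent_simple: "independent \<Delta>"
  using simple_roots by (auto simp: simple_roots_def)

lemma finite_simple: "finite \<Delta>"
  using simple_subset finite_roots finite_subset by blast

lemma positive_roots_subset: "P \<subseteq> \<Phi>" by (auto simp: positive_roots_def)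

lemma positive_or_negative:
  assumes "\<alpha> \<in> \<Phi>" obtains "\<alpha> \<in> P" | "- \<alpha> \<in> P"
proof -
  obtain c :: "'a \<Rightarrow> int" where c: "\<alpha> = (\<Sum>\<beta>\<in>\<Delta>. of_int (c \<beta>) *\<^sub>R \<beta>)"
    "(\<forall>\<beta>\<in>\<Delta>. 0 \<le> c \<beta>) \<or> (\<forall>\<beta>\<in>\<Delta>. c \<beta> \<le> 0)"
    using simple_roots assms by (auto simp: simple_roots_def)
  from c(2) show ?thesis
  proof
    assume "\<forall>\<beta>\<in>\<Delta>. 0 \<le> c \<beta>"
    thus ?thesis using c(1) assms that(1) by (auto simp: positive_roots_def)
  next
    assume "\<forall>\<beta>\<in>\<Delta>. c \<beta> \<le> 0"
    moreover have "- \<alpha> = (\<Sum>\<beta>\<in>\<Delta>. of_int (- c \<beta>) *\<^sub>R \<beta>)" by (simp add: c(1) sum_negf)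
    ultimately have "- \<alpha> \<in> P" using neg_root[OF assms] by (auto simp: positive_roots_def intro!: exI[of _ "\<lambda>\<beta>. - c \<beta>"])
    thus ?thesis by (rule that(2))
  qed
qed

lemma positive_functional:
  "\<exists>\<rho>. \<forall>\<alpha>\<in>P. 0 < \<alpha> \<bullet> \<rho>"
proof -
  obtain \<rho> where \<rho>: "\<And>\<alpha>. \<alpha> \<in> \<Delta> \<Longrightarrow> \<alpha> \<bullet> \<rho> = 1"
    using independent_obtain_height[OF independent_simple] by blast
  have "0 < \<alpha> \<bullet> \<rho>" if "\<alpha> \<in> P" for \<alpha>
  proof -
    obtain c :: "'a \<Rightarrow> int" where c: "\<alpha> = (\<Sum>\<beta>\<in>\<Delta>. of_int (c \<beta>) *\<^sub>R \<beta>)" "\<forall>\<beta>\<in>\<Delta>. 0 \<le> c \<beta>"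
      using \<open>\<alpha> \<in> P\<close> by (auto simp: positive_roots_def)
    have eq: "\<alpha> \<bullet> \<rho> = (\<Sum>\<beta>\<in>\<Delta>. of_int (c \<beta>))" by (simp add: c(1) inner_sum_left \<rho>)
    moreover have "(\<Sum>\<beta>\<in>\<Delta>. real_of_int (c \<beta>)) \<noteq> 0"
    proof
      assume "(\<Sum>\<beta>\<in>\<Delta>. real_of_int (c \<beta>)) = 0"
      hence "\<forall>\<beta>\<in>\<Delta>. c \<beta> = 0"
        using c(2) by (subst (asm) sum_nonneg_eq_0_iff[OF finite_simple]) auto
      hence "\<alpha> = 0" by (simp add: c(1))
      thus False using \<open>\<alpha> \<in> P\<close> positive_roots_subset zero_not_root by blast
    qed
    moreover have "0 \<le> (\<Sum>\<beta>\<in>\<Delta>. real_of_int (c \<beta>))" using c(2) by (simp add: sum_nonneg)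
    ultimately show ?thesis by linarith
  qed
  thus ?thesis by blast
qed

lemma simple_positive: "\<Delta> \<subseteq> P"
proof
  fix \<alpha> assume \<alpha>: "\<alpha> \<in> \<Delta>"
  define c :: "'a \<Rightarrow> int" where "c \<beta> = (if \<beta> = \<alpha> then 1 else 0)" for \<beta>
  have "\<alpha> = (\<Sum>\<beta>\<in>\<Delta>. of_int (c \<beta>) *\<^sub>R \<beta>)"
    using \<alpha> finite_simple
    by (simp add: c_def if_distrib[of of_int] if_distrib[of "\<lambda>c. c *\<^sub>R _"] cong: if_cong)
  moreover have "\<forall>\<beta>\<in>\<Delta>. 0 \<le> c \<beta>" by (simp add: c_def)
  ultimately show "\<alpha> \<in> P"
    using \<alpha> simple_subset unfolding positive_roots_def by blast
qed

end

locale roots_with_ideal = based_roots +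
  fixes I
  assumes ideal: "root_ideal (positive_roots \<Phi> \<Delta>) I"
begin

abbreviation "M \<equiv> minimal_roots P I"

lemma I_subset: "I \<subseteq> P" and M_subset: "M \<subseteq> I"
  using ideal by (auto simp: root_ideal_def minimal_roots_def)

lemma root_less_diff: "\<beta> - \<alpha> \<in> P \<Longrightarrow> root_less P \<alpha> \<beta>"
  unfolding root_less_def by (intro exI[of _ "[\<beta> - \<alpha>]"]) auto

text \<open>Anything above a root of the ideal by a positive root is again in the ideal, if it is a root at
  all, but then it is not minimal.\<close>
lemma diff_ideal_not_positive:
  assumes "\<beta> \<in> I" "\<delta> \<in> (P - I) \<union> M" shows "\<delta> - \<beta> \<notin> P"
proof
  assume d: "\<delta> - \<beta> \<in> P"
  have "\<delta> \<in> P" using assms(2) I_subset M_subset by blast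
  hence "\<delta> \<in> I" using ideal assms(1) d by (force simp: root_ideal_def)
  hence "\<delta> \<in> M" using assms(2) by blast
  thus False using root_less_diff[OF d] assms(1) I_subset by (auto simp: minimal_roots_def)
qed

end

section \<open>Relations between roots of an ideal and roots below it\<close>

lemma inner_sum_mset_left: "sum_mset X \<bullet> y = (\<Sum>x\<in>#X. x \<bullet> (y::'a::real_inner))"
  by (induction X) (auto simp: inner_add_left)

lemma sum_mset_pos:
  "X \<noteq> {#} \<Longrightarrow> (\<And>x. x \<in># X \<Longrightarrow> 0 < f x) \<Longrightarrow> 0 < (\<Sum>x\<in>#X. f x :: real)"
proof (induction X)
  case (add a X)
  thus ?case by (cases "X = {#}") (auto intro!: add_pos_pos)
qed simp

lemma sum_mset_pos_obtains:
  assumes "0 < (\<Sum>x\<in>#X. f x :: real)" obtains x where "x \<in># X" "0 < f x"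
proof -
  have "(\<Sum>x\<in>#X. f x) \<le> 0" if "\<forall>x\<in>#X. f x \<le> 0"
    using that by (induction X) (auto intro!: add_nonpos_nonpos)
  thus ?thesis using assms that by (meson not_le)
qed

context roots_with_ideal begin

text \<open>The combinatorial heart of the proof: roots outside the ideal together with minimal ones cannot
  add up to a sum of at least as many roots of the ideal, even with positive roots added to the
  latter, except trivially. Whenever a root on the left has positive inner product with a root
  \<^term>\<open>\<delta>\<close> on the right, their difference is zero or a root, and both can be replaced by that difference. Roots of
  the ideal cannot be smaller than the \<^term>\<open>\<delta>\<close> they meet, so both cancel, at most leaving a
  positive root on the left; an auxiliary root either shrinks \<^term>\<open>\<delta>\<close>, which thereby leaves the
  ideal for good, or uses it up. The measure weighs the members of \<^term>\<open>D\<close> twice to pay for the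
  positive root that is left behind.\<close>
lemma exchange:
  assumes "set_mset B \<subseteq> I" "set_mset C \<subseteq> P" "set_mset D \<subseteq> (P - I) \<union> M"
    and "sum_mset B + sum_mset C = sum_mset D" "size D \<le> size B"
  shows "C = {#} \<and> B = D"
  using assms
proof (induction "2 * size D + size C" arbitrary: B C D rule: less_induct)
  case less
  note B = less.prems(1) and C = less.prems(2) and D = less.prems(3)
    and sum = less.prems(4) and size = less.prems(5)
  obtain \<rho> where \<rho>: "\<And>\<alpha>. \<alpha> \<in> P \<Longrightarrow> 0 < \<alpha> \<bullet> \<rho>" using positive_functional by blast
  have DP: "set_mset D \<subseteq> P" using D I_subset M_subset by blast
  show ?case
  proof (cases "\<exists>\<beta>\<in>#B. \<exists>\<delta>\<in>#D. 0 < \<beta> \<bullet> \<delta>")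
    case True
    then obtain \<beta> \<delta> where bd: "\<beta> \<in># B" "\<delta> \<in># D" "0 < \<beta> \<bullet> \<delta>" by blast
    obtain B' D' where B': "B = add_mset \<beta> B'" and D': "D = add_mset \<delta> D'"
      using bd by (meson mset_add)
    show ?thesis
    proof (cases "\<beta> = \<delta>")
      case True
      have "C = {#} \<and> B' = D'"
        by (rule less.hyps) (use B C D sum size B' D' True in auto)
      thus ?thesis using B' D' True by simp
    next
      case False
      have "\<beta> \<in> \<Phi>" "\<delta> \<in> \<Phi>" using bd B DP I_subset positive_roots_subset by blast+
      hence "\<beta> - \<delta> \<in> \<Phi>" using diff_root False bd(3) by blast
      moreover have "- (\<beta> - \<delta>) \<notin> P"
        using diff_ideal_not_positive[of \<beta> \<delta>] bd B D by auto
      ultimately have "\<beta> - \<delta> \<in> P" using positive_or_negative by blast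
      hence "add_mset (\<beta> - \<delta>) C = {#} \<and> B' = D'"
        by (intro less.hyps) (use B C D sum size B' D' in \<open>auto simp: algebra_simps\<close>)
      thus ?thesis by simp
    qed
  next
    case False
    show ?thesis
    proof (cases "D = {#}")
      case True
      have "B + C = {#}"
      proof (rule ccontr)
        assume "B + C \<noteq> {#}"
        hence "0 < (\<Sum>x\<in>#B + C. x \<bullet> \<rho>)"
          using B C I_subset by (intro sum_mset_pos \<rho>) auto
        thus False using sum True by (simp add: inner_sum_mset_left[symmetric] inner_add_left[symmetric])
      qed
      thus ?thesis using True by simp
    next
      case D_ne: False
      have "0 < (\<Sum>x\<in>#D. x \<bullet> \<rho>)" using DP D_ne by (intro sum_mset_pos \<rho>) auto
      hence "sum_mset D \<noteq> 0" by (auto simp: inner_sum_mset_left[symmetric])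
      hence "0 < (\<Sum>\<delta>\<in>#D. \<delta> \<bullet> sum_mset D)" by (simp add: inner_sum_mset_left[symmetric])
      then obtain \<delta> where \<delta>: "\<delta> \<in># D" "0 < \<delta> \<bullet> sum_mset D" by (rule sum_mset_pos_obtains)
      have "\<not> 0 < (\<Sum>\<beta>\<in>#B. \<beta> \<bullet> \<delta>)" using False \<delta>(1) by (auto elim!: sum_mset_pos_obtains)
      moreover have "0 < sum_mset B \<bullet> \<delta> + sum_mset C \<bullet> \<delta>"
        using \<delta>(2) unfolding sum[symmetric] by (simp add: inner_add_right inner_commute)
      ultimately have "0 < (\<Sum>\<alpha>\<in>#C. \<alpha> \<bullet> \<delta>)" by (simp add: inner_sum_mset_left)
      then obtain \<alpha> where \<alpha>: "\<alpha> \<in># C" "0 < \<alpha> \<bullet> \<delta>" by (rule sum_mset_pos_obtains)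
      obtain C' D' where C': "C = add_mset \<alpha> C'" and D': "D = add_mset \<delta> D'"
        using \<alpha> \<delta> by (meson mset_add)
      show ?thesis
      proof (cases "\<alpha> = \<delta>")
        case True
        have "C' = {#} \<and> B = D'"
          by (rule less.hyps) (use B C D sum size C' D' True in \<open>auto simp: algebra_simps\<close>)
        \<comment> \<open>A member of \<^term>\<open>D\<close> is lost without one of \<^term>\<open>B\<close>, contradicting the size bound.\<close>
        thus ?thesis using size D' by simp
      next
        case False
        have "\<alpha> \<in> \<Phi>" "\<delta> \<in> \<Phi>" using \<alpha> \<delta> C DP positive_roots_subset by blast+
        hence "\<alpha> - \<delta> \<in> \<Phi>" using diff_root False \<alpha>(2) by blast
        then consider "\<alpha> - \<delta> \<in> P" | "\<delta> - \<alpha> \<in> P"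
          using positive_or_negative[of "\<alpha> - \<delta>"] by (metis minus_diff_eq)
        thus ?thesis
        proof cases
          case 1
          have "add_mset (\<alpha> - \<delta>) C' = {#} \<and> B = D'"
            by (rule less.hyps) (use B C D sum size C' D' 1 in \<open>auto simp: algebra_simps\<close>)
          thus ?thesis by simp
        next
          case 2
          have notI: "\<delta> - \<alpha> \<notin> I"
            using diff_ideal_not_positive[of "\<delta> - \<alpha>" \<delta>] \<alpha>(1) \<delta>(1) C D by auto
          have "C' = {#} \<and> B = add_mset (\<delta> - \<alpha>) D'"
            by (rule less.hyps) (use B C D sum size C' D' 2 notI in \<open>auto simp: algebra_simps\<close>)
          thus ?thesis using B notI by auto
        qed
      qed
    qed
  qed
qed

end

lemma sum_mset_replicate_scaleR: "sum_mset (replicate_mset n (a::'a::real_vector)) = of_nat n *\<^sub>R a"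
  by (induction n) (auto simp: algebra_simps)

lemma sum_replicate_mset:
  fixes A :: "'a::real_vector set"
  assumes "finite A"
  shows "sum_mset (\<Sum>a\<in>A. replicate_mset (k a) a) = (\<Sum>a\<in>A. of_nat (k a) *\<^sub>R a)"
    and "size (\<Sum>a\<in>A. replicate_mset (k a) a) = (\<Sum>a\<in>A. k a)"
    and "set_mset (\<Sum>a\<in>A. replicate_mset (k a) a) \<subseteq> A"
  using assms by (induction A rule: finite_induct) (auto simp: sum_mset_replicate_scaleR)

context roots_with_ideal begin

lemma minimal_diff_not_root:
  assumes "\<alpha> \<in> M" "\<beta> \<in> M" shows "\<alpha> - \<beta> \<notin> \<Phi>"
proof
  assume "\<alpha> - \<beta> \<in> \<Phi>"
  moreover have "\<alpha> - \<beta> \<notin> P" "\<beta> - \<alpha> \<notin> P"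
    using diff_ideal_not_positive assms M_subset by blast+
  ultimately show False using positive_or_negative[of "\<alpha> - \<beta>"] by auto
qed

lemma minimal_roots_subset: "M \<subseteq> \<Phi>"
  using M_subset I_subset positive_roots_subset by blast

lemma independent_minimal: "independent M"
proof -
  obtain \<rho> where \<rho>: "\<And>\<alpha>. \<alpha> \<in> P \<Longrightarrow> 0 < \<alpha> \<bullet> \<rho>" using positive_functional by blast
  show ?thesis
  proof (rule obtuse_independent)
    show "finite M" using minimal_roots_subset finite_roots finite_subset by blast
    show "\<alpha> \<bullet> \<beta> \<le> 0" if "\<alpha> \<in> M" "\<beta> \<in> M" "\<alpha> \<noteq> \<beta>" for \<alpha> \<beta>
      using diff_root[of \<alpha> \<beta>] minimal_diff_not_root[of \<alpha> \<beta>] that minimal_roots_subset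
      by (meson not_le subsetD)
    show "0 < \<alpha> \<bullet> \<rho>" if "\<alpha> \<in> M" for \<alpha> using \<rho> that M_subset I_subset by blast
  qed
qed

text \<open>A root of height 0 would satisfy an integral relation \<open>q \<beta> = \<Sum>\<alpha>\<in>M. p(\<alpha>) \<alpha>\<close> in which
  the positive and the negative coefficients have the same total. Moving the negative ones to the
  other side gives an instance of \<open>exchange\<close> whose auxiliary roots are \<open>q\<close> copies of
  \<^term>\<open>\<beta>\<close>, or of its negative when that is the positive one.\<close>
lemma height_nonzero:
  assumes x: "\<And>\<alpha>. \<alpha> \<in> M \<Longrightarrow> \<alpha> \<bullet> x = 1"
    and \<beta>: "\<beta> \<in> \<Phi>" "\<beta> \<in> span M"
  shows "\<beta> \<bullet> x \<noteq> 0"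
proof -
  have pos: "\<beta> \<bullet> x \<noteq> 0" if \<beta>: "\<beta> \<in> P" "\<beta> \<in> span M" for \<beta>
  proof
    assume 0: "\<beta> \<bullet> x = 0"
    have fin: "finite M" using minimal_roots_subset finite_roots finite_subset by blast
    obtain q :: int and p :: "'a \<Rightarrow> int"
      where q: "0 < q" and qp: "of_int q *\<^sub>R \<beta> = (\<Sum>\<alpha>\<in>M. of_int (p \<alpha>) *\<^sub>R \<alpha>)"
      using root_in_span_rational[OF minimal_roots_subset, of \<beta>] \<beta> positive_roots_subset by blast
    define B where "B = (\<Sum>\<alpha>\<in>M. replicate_mset (nat (- p \<alpha>)) \<alpha>)"
    define D where "D = (\<Sum>\<alpha>\<in>M. replicate_mset (nat (p \<alpha>)) \<alpha>)"
    define C where "C = replicate_mset (nat q) \<beta>"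
    have p: "real_of_int (p \<alpha>) = real (nat (p \<alpha>)) - real (nat (- p \<alpha>))" for \<alpha> by simp
    have "sum_mset C = sum_mset D - sum_mset B"
      using q qp unfolding B_def C_def D_def sum_replicate_mset[OF fin] sum_mset_replicate_scaleR p
      by (simp add: scaleR_left_diff_distrib sum_subtractf)
    hence sum: "sum_mset B + sum_mset C = sum_mset D" by simp
    have "0 = (of_int q *\<^sub>R \<beta>) \<bullet> x" using 0 by simp
    also have "\<dots> = (\<Sum>\<alpha>\<in>M. real_of_int (p \<alpha>))"
      unfolding qp by (simp add: inner_sum_left x)
    also have "\<dots> = real (size D) - real (size B)"
      unfolding B_def D_def sum_replicate_mset[OF fin] p by (simp add: sum_subtractf)
    finally have size: "size D \<le> size B" by simp
    have "C = {#} \<and> B = D"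
    proof (rule exchange[OF _ _ _ sum size])
      have "set_mset B \<subseteq> M" unfolding B_def by (rule sum_replicate_mset(3)[OF fin])
      thus "set_mset B \<subseteq> I" using M_subset by blast
      have "set_mset D \<subseteq> M" unfolding D_def by (rule sum_replicate_mset(3)[OF fin])
      thus "set_mset D \<subseteq> (P - I) \<union> M" by blast
      show "set_mset C \<subseteq> P" using \<beta> by (auto simp: C_def)
    qed
    thus False using q by (simp add: C_def)
  qed
  from \<beta>(1) show ?thesis
  proof (cases rule: positive_or_negative)
    case 1 thus ?thesis using pos \<beta>(2) by blast
  next
    case 2 thus ?thesis using pos[of "- \<beta>"] \<beta>(2) span_neg by auto
  qed
qed

end

section \<open>Conjugation into the simple roots\<close>

context unit_height begin

text \<open>A vector \<open>z\<close> orthogonal to exactly the roots in the span of \<^term>\<open>A\<close>, perturbed by a small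
  multiple of \<^term>\<open>x\<close>, lies in an open chamber whose closure has the span of \<^term>\<open>A\<close> as the
  normal space of a face. Bring this chamber to the dominant one by \<open>w\<close> and write the image of
  \<open>\<gamma> \<in> A\<close> in simple roots. Pairing with \<open>z\<close> shows that only simple roots from the image
  of the span of \<^term>\<open>A\<close> occur. As positive integral heights are at least 1 and \<open>\<gamma>\<close> has height 1,
  exactly one of them occurs, with coefficient 1.\<close>
lemma conjugate_to_simple:
  assumes "simple_roots \<Phi> \<Delta>"
  shows "\<exists>w\<in>weyl_group \<Phi>. w ` A \<subseteq> \<Delta>"
proof -
  interpret based_roots \<Phi> \<Delta> by unfold_locales (rule assms)
  obtain \<rho> where \<rho>: "\<And>\<alpha>. \<alpha> \<in> \<Delta> \<Longrightarrow> 0 < \<alpha> \<bullet> \<rho>" using positive_functional simple_positive by (metis subsetD)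
  obtain z where z: "\<And>a. a \<in> span A \<Longrightarrow> a \<bullet> z = 0" "\<And>\<beta>. \<beta> \<in> \<Phi> - span A \<Longrightarrow> \<beta> \<bullet> z \<noteq> 0"
    using generic_orthogonal_vector[of "\<Phi> - span A" A] finite_roots by blast
  \<comment> \<open>Large enough for \<open>z\<close> to decide the sign of \<open>y\<close> on the roots outside \<^term>\<open>span A\<close>.\<close>
  define K where "K = 1 + (\<Sum>\<beta>\<in>\<Phi>. \<bar>\<beta> \<bullet> x\<bar> / \<bar>\<beta> \<bullet> z\<bar>)"
  define y where "y = K *\<^sub>R z + x"
  have K: "K > 0" unfolding K_def by (intro add_pos_nonneg sum_nonneg) auto
  have y_nonneg: "if \<beta> \<in> span A then \<beta> \<bullet> z = 0 \<and> 0 < \<beta> \<bullet> x else 0 < \<beta> \<bullet> z"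
    if \<beta>: "\<beta> \<in> \<Phi>" "0 \<le> \<beta> \<bullet> y" for \<beta>
  proof (cases "\<beta> \<in> span A")
    case True
    thus ?thesis using z(1)[OF True] regular[OF \<beta>(1) True] \<beta>(2) by (simp add: y_def inner_add_right)
  next
    case False
    hence nz: "\<bar>\<beta> \<bullet> z\<bar> > 0" using z(2) \<beta>(1) by simp
    have "\<bar>\<beta> \<bullet> x\<bar> / \<bar>\<beta> \<bullet> z\<bar> \<le> (\<Sum>\<beta>\<in>\<Phi>. \<bar>\<beta> \<bullet> x\<bar> / \<bar>\<beta> \<bullet> z\<bar>)"
      using \<beta>(1) finite_roots by (intro member_le_sum) auto
    hence "\<bar>\<beta> \<bullet> x\<bar> / \<bar>\<beta> \<bullet> z\<bar> < K" by (simp add: K_def)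
    hence "\<bar>\<beta> \<bullet> x\<bar> < K * \<bar>\<beta> \<bullet> z\<bar>" using nz by (simp add: divide_less_eq)
    moreover have "K * (\<beta> \<bullet> z) + \<beta> \<bullet> x \<ge> 0" using \<beta>(2) by (simp add: y_def inner_add_right)
    ultimately have "\<not> \<beta> \<bullet> z < 0" using K by auto
    thus ?thesis using nz False by auto
  qed
  obtain w where w: "w \<in> weyl_group \<Phi>"
    and max: "\<And>v. v \<in> weyl_group \<Phi> \<Longrightarrow> v y \<bullet> \<rho> \<le> w y \<bullet> \<rho>"
    using weyl_obtain_max[of \<Phi>] by blast
  have "\<exists>\<beta>\<in>\<Phi>. w \<beta> = \<delta> \<and> 0 \<le> \<beta> \<bullet> y" if \<delta>: "\<delta> \<in> \<Delta>" for \<delta>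
  proof -
    have "\<delta> \<in> \<Phi>" using \<delta> simple_subset by blast
    then obtain \<beta> where \<beta>: "\<beta> \<in> \<Phi>" "w \<beta> = \<delta>" using weyl_image[OF w] by (metis imageE)
    have "0 \<le> w y \<bullet> \<delta>"
      using weyl_max_dominant[OF _ w, of y \<rho> \<delta>] max \<open>\<delta> \<in> \<Phi>\<close> \<rho>[OF \<delta>] by blast
    thus ?thesis using \<beta> weyl_inner[OF w, of y \<beta>] by (auto simp: inner_commute)
  qed
  then obtain b where b: "\<And>\<delta>. \<delta> \<in> \<Delta> \<Longrightarrow> b \<delta> \<in> \<Phi> \<and> w (b \<delta>) = \<delta> \<and> 0 \<le> b \<delta> \<bullet> y" by metis
  have bz: "0 \<le> b \<delta> \<bullet> z" if "\<delta> \<in> \<Delta>" for \<delta>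
    using y_nonneg[of "b \<delta>"] b[OF that] by (auto split: if_splits)
  have bx: "1 \<le> b \<delta> \<bullet> x" if \<delta>: "\<delta> \<in> \<Delta>" "b \<delta> \<bullet> z = 0" for \<delta>
  proof -
    have "b \<delta> \<in> span A" "0 < b \<delta> \<bullet> x"
      using y_nonneg[of "b \<delta>"] b[OF \<delta>(1)] \<delta>(2) by (auto split: if_splits)
    moreover from this obtain m :: int where "b \<delta> \<bullet> x = m"
      using height_int[of "b \<delta>"] b[OF \<delta>(1)] by (auto elim: Ints_cases)
    ultimately show ?thesis by simp
  qed
  have "w \<gamma> \<in> \<Delta>" if \<gamma>: "\<gamma> \<in> A" for \<gamma>
  proof -
    have "w \<gamma> \<in> \<Phi>" using weyl_root[OF w] A_roots \<gamma> by blast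
    then obtain c :: "'a \<Rightarrow> int" where c: "w \<gamma> = (\<Sum>\<delta>\<in>\<Delta>. of_int (c \<delta>) *\<^sub>R \<delta>)"
      "(\<forall>\<delta>\<in>\<Delta>. 0 \<le> c \<delta>) \<or> (\<forall>\<delta>\<in>\<Delta>. c \<delta> \<le> 0)"
      using simple_roots by (auto simp: simple_roots_def)
    have expand: "\<gamma> \<bullet> u = (\<Sum>\<delta>\<in>\<Delta>. of_int (c \<delta>) * (b \<delta> \<bullet> u))" for u
    proof -
      have "\<gamma> \<bullet> u = w \<gamma> \<bullet> w u" by (simp add: weyl_inner[OF w])
      also have "\<dots> = (\<Sum>\<delta>\<in>\<Delta>. of_int (c \<delta>) * (w (b \<delta>) \<bullet> w u))"
        using b by (simp add: c(1) inner_sum_left)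
      finally show ?thesis by (simp add: weyl_inner[OF w])
    qed
    have \<gamma>y: "\<gamma> \<bullet> y = 1" and \<gamma>z: "\<gamma> \<bullet> z = 0"
      using z(1)[of \<gamma>] height_1[OF \<gamma>] \<gamma> by (auto simp: y_def inner_add_right span_base)
    have "\<not> (\<forall>\<delta>\<in>\<Delta>. c \<delta> \<le> 0)"
    proof
      assume "\<forall>\<delta>\<in>\<Delta>. c \<delta> \<le> 0"
      hence "\<gamma> \<bullet> y \<le> 0" unfolding expand using b by (intro sum_nonpos mult_nonpos_nonneg) auto
      thus False using \<gamma>y by simp
    qed
    hence c0: "\<forall>\<delta>\<in>\<Delta>. 0 \<le> c \<delta>" and "\<exists>\<delta>\<in>\<Delta>. 0 < c \<delta>" using c(2) by (auto simp: not_le)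
    then obtain \<epsilon> where \<epsilon>: "\<epsilon> \<in> \<Delta>" "0 < c \<epsilon>" by blast
    have "\<forall>\<delta>\<in>\<Delta>. of_int (c \<delta>) * (b \<delta> \<bullet> z) = 0"
      using \<gamma>z c0 bz unfolding expand by (subst (asm) sum_nonneg_eq_0_iff[OF finite_simple]) auto
    hence cz: "b \<delta> \<bullet> z = 0" if "\<delta> \<in> \<Delta>" "c \<delta> \<noteq> 0" for \<delta> using that by auto
    have le: "of_int (c \<delta>) \<le> of_int (c \<delta>) * (b \<delta> \<bullet> x)" if "\<delta> \<in> \<Delta>" for \<delta>
      using bx[OF that cz[OF that]] c0 that by (cases "c \<delta> = 0") (auto simp: mult_le_cancel_left1)
    have "(\<Sum>\<delta>\<in>\<Delta>. real_of_int (c \<delta>)) \<le> \<gamma> \<bullet> x" unfolding expand by (intro sum_mono le)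
    hence "(\<Sum>\<delta>\<in>\<Delta>. c \<delta>) \<le> 1" using height_1[OF \<gamma>] by (simp flip: of_int_sum)
    hence tot: "c \<epsilon> + (\<Sum>\<delta>\<in>\<Delta> - {\<epsilon>}. c \<delta>) \<le> 1"
      using sum.remove[OF finite_simple \<epsilon>(1), of c] by simp
    have rest0: "0 \<le> (\<Sum>\<delta>\<in>\<Delta> - {\<epsilon>}. c \<delta>)" using c0 by (intro sum_nonneg) auto
    hence "(\<Sum>\<delta>\<in>\<Delta> - {\<epsilon>}. c \<delta>) = 0" and c\<epsilon>: "c \<epsilon> = 1" using tot \<epsilon>(2) by linarith+
    hence "\<forall>\<delta>\<in>\<Delta> - {\<epsilon>}. c \<delta> = 0"
      using c0 finite_simple by (subst (asm) sum_nonneg_eq_0_iff) auto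
    hence "w \<gamma> = \<epsilon>"
      using c\<epsilon> by (simp add: c(1) sum.remove[OF finite_simple \<epsilon>(1)])
    thus ?thesis using \<epsilon>(1) by simp
  qed
  thus ?thesis using w by blast
qed

end

theorem mainTheorem1:
  fixes \<Phi> \<Delta> I :: "'a::euclidean_space set"
  assumes "irreducible_root_system \<Phi>"
    and "simple_roots \<Phi> \<Delta>"
    and "root_ideal (positive_roots \<Phi> \<Delta>) I"
  shows "\<exists>w\<in>weyl_group \<Phi>. w ` minimal_roots (positive_roots \<Phi> \<Delta>) I \<subseteq> \<Delta>"
proof -
  interpret roots_with_ideal \<Phi> \<Delta> I
    using assms by unfold_locales (auto simp: irreducible_root_system_def)
  obtain x where x: "x \<in> span M" "\<And>\<alpha>. \<alpha> \<in> M \<Longrightarrow> \<alpha> \<bullet> x = 1"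
    using independent_obtain_height[OF independent_minimal] by blast
  interpret unit_height \<Phi> M x
    using x minimal_roots_subset minimal_diff_not_root height_nonzero by unfold_locales auto
  show ?thesis by (rule conjugate_to_simple) (rule assms(2))
qed

end
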